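(* Let $q\ge2$ be an integer, $\theta_0=0$, $(\theta_1,\cdots,\theta_{q-1})\in\{0,1\}^{q-1}\setminus\{0^{q-1}\}$, let $(\theta_n)_{n\ge0}$ be the $(0,\theta_1,\cdots,\theta_{q-1})$-Thue-Morse sequence, and let $\delta_n:=(-1)^{\theta_n}$. Let $R\in\mathbb{C}(X)$ be a rational function such that the values $R(n)$ are defined and non-zero for all $n\in\mathbb{N}=\{1,2,3,\dots\}$. Then: (1) the infinite product $\prod_{n=1}^\infty (R(n))^{\delta_n}$ converges if and only if the numerator and the denominator of $R$ have the same degree and the same leading coefficient; (2) the infinite product $\prod_{n=1}^\infty (R(n))^{\theta_n}$ converges if and only if the numerator and the denominator of $R$ have the same degree, the same leading coefficient and the same sum of roots (in $\mathbb{C}$).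
   Context: For an integer $q\ge2$ and $\theta_1,\dots,\theta_{q-1}\in\{0,1\}$, the $(0,\theta_1,\cdots,\theta_{q-1})$-Thue-Morse sequence $(\theta_n)_{n\ge0}$ is the unique fixed point of the morphism on $\{0,1\}$ given by $0\mapsto0\theta_1\cdots\theta_{q-1}$, $1\mapsto1\overline{\theta}_1\cdots\overline{\theta}_{q-1}$, beginning with $\theta_0:=0$, where $\overline{0}:=1$ and $\overline{1}:=0$. *)

theory Defs
  imports
    "HOL-Analysis.Analysis"
    "HOL-Computational_Algebra.Computational_Algebra"
    "HOL-Computational_Algebra.Field_as_Ring"
    "HOL-Library.Stream"
begin

text \<open>The list \<open>ts\<close> holds the letters \<open>\<theta>\<^sub>1, \<dots>, \<theta>\<^sub>q\<^sub>-\<^sub>1\<close>; on the alphabet \<open>{0, 1}\<close> the bar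
  operation is \<open>\<lambda>a. 1 - a\<close>.\<close>

definition tm_morphism :: "nat list \<Rightarrow> nat \<Rightarrow> nat list" where
  "tm_morphism ts a = (if a = 0 then 0 # ts else 1 # map (\<lambda>t. 1 - t) ts)"

definition tm_fixed_point :: "nat list \<Rightarrow> nat stream \<Rightarrow> bool" where
  "tm_fixed_point ts s \<longleftrightarrow>
     s \<in> streams {0, 1} \<and> shd s = 0 \<and> flat (smap (tm_morphism ts) s) = s"

definition thue_morse :: "nat list \<Rightarrow> nat stream" where
  "thue_morse ts = (THE s. tm_fixed_point ts s)"

lemma length_tm_morphism [simp]: "length (tm_morphism ts a) = Suc (length ts)"
  by (simp add: tm_morphism_def)

lemma tm_morphism_nonempty [simp]: "tm_morphism ts a \<noteq> []"
  by (simp add: tm_morphism_def)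

lemma snth_flat_tm_morphism:
  "flat (smap (tm_morphism ts) s) !! n =
     tm_morphism ts (s !! (n div Suc (length ts))) ! (n mod Suc (length ts))"
proof (induction n arbitrary: s rule: less_induct)
  case (less n)
  let ?q = "Suc (length ts)"
  have *: "flat (smap (tm_morphism ts) s) !! n =
     (if n < ?q then tm_morphism ts (shd s) ! n
      else flat (smap (tm_morphism ts) (stl s)) !! (n - ?q))"
    by (subst flat_snth) (auto simp: stream.set_map)
  show ?case
  proof (cases "n < ?q")
    case True
    then show ?thesis using * by simp
  next
    case False
    then have "n div ?q = Suc ((n - ?q) div ?q)" "n mod ?q = (n - ?q) mod ?q"
      by (auto simp: le_div_geq le_mod_geq)
    moreover have "flat (smap (tm_morphism ts) (stl s)) !! (n - ?q) =
        tm_morphism ts (stl s !! ((n - ?q) div ?q)) ! ((n - ?q) mod ?q)"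
      using False by (intro less.IH) simp
    ultimately show ?thesis using * False by simp
  qed
qed

lemma tm_fixed_point_rec:
  assumes "tm_fixed_point ts s"
  shows "s !! n = tm_morphism ts (s !! (n div Suc (length ts))) ! (n mod Suc (length ts))"
  using assms snth_flat_tm_morphism[of ts s n] by (simp add: tm_fixed_point_def)

lemma tm_fixed_point_unique:
  assumes "tm_fixed_point ts s" "tm_fixed_point ts s'" "ts \<noteq> []"
  shows "s = s'"
proof -
  have "s !! n = s' !! n" for n
  proof (induction n rule: less_induct)
    case (less n)
    show ?case
    proof (cases "n = 0")
      case True
      then show ?thesis using assms by (simp add: tm_fixed_point_def)
    next
      case False
      then have "n div Suc (length ts) < n"
        using assms(3) by (intro div_less_dividend) (auto simp: Suc_lessI)
      then show ?thesis
        using less.IH tm_fixed_point_rec[OF assms(1), of n] tm_fixed_point_rec[OF assms(2), of n]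
        by simp
    qed
  qed
  then show ?thesis by (metis ext smap_alt stream.map_ident)
qed

function tm_seq :: "nat list \<Rightarrow> nat \<Rightarrow> nat" where
  "tm_seq ts n = (if n = 0 \<or> ts = [] then 0
     else tm_morphism ts (tm_seq ts (n div Suc (length ts))) ! (n mod Suc (length ts)))"
  by pat_completeness auto
termination
  by (relation "Wellfounded.measure snd") (auto intro!: div_less_dividend)

declare tm_seq.simps [simp del]

lemma tm_morphism_letters:
  assumes "set ts \<subseteq> {0, 1}" shows "set (tm_morphism ts a) \<subseteq> {0, 1}"
  using assms by (auto simp: tm_morphism_def)

lemma tm_fixed_point_exists:
  assumes "ts \<noteq> []" "set ts \<subseteq> {0, 1}"
  shows "tm_fixed_point ts (smap (tm_seq ts) nats)"
proof -
  let ?q = "Suc (length ts)" and ?s = "smap (tm_seq ts) nats"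
  have 0: "tm_seq ts 0 = 0"
    by (simp add: tm_seq.simps)
  have rec: "tm_seq ts n = tm_morphism ts (tm_seq ts (n div ?q)) ! (n mod ?q)" for n
  proof (cases "n = 0")
    case True
    then show ?thesis by (simp add: 0 tm_morphism_def)
  next
    case False
    then show ?thesis using assms(1) by (subst tm_seq.simps) simp
  qed
  have "tm_seq ts n \<in> {0, 1}" for n
    unfolding rec[of n]
    by (rule subsetD[OF tm_morphism_letters[OF assms(2)] nth_mem]) simp
  then have "?s \<in> streams {0, 1}"
    unfolding streams_iff_sset stream.set_map by (rule image_subsetI)
  moreover have "flat (smap (tm_morphism ts) ?s) !! n = ?s !! n" for n
    by (simp add: snth_flat_tm_morphism rec[symmetric])
  then have "flat (smap (tm_morphism ts) ?s) = ?s"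
    by (metis ext smap_alt stream.map_ident)
  ultimately show ?thesis
    by (simp add: tm_fixed_point_def 0)
qed

lemma tm_fixed_point_ex1:
  assumes "ts \<noteq> []" "set ts \<subseteq> {0, 1}"
  shows "\<exists>!s. tm_fixed_point ts s"
  using tm_fixed_point_exists tm_fixed_point_unique assms by blast

lemma tm_fixed_point_thue_morse:
  assumes "ts \<noteq> []" "set ts \<subseteq> {0, 1}"
  shows "tm_fixed_point ts (thue_morse ts)"
  unfolding thue_morse_def by (rule theI'[OF tm_fixed_point_ex1[OF assms]])

text \<open>Elements of \<open>\<complex>(X)\<close> have type \<^typ>\<open>complex poly fract\<close>. The numerator and denominator are
  those of the reduced fraction whose denominator is monic.\<close>

definition rat_num :: "complex poly fract \<Rightarrow> complex poly" where
  "rat_num R = fst (quot_of_fract R)"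

definition rat_denom :: "complex poly fract \<Rightarrow> complex poly" where
  "rat_denom R = snd (quot_of_fract R)"

lemma rat_num_denom:
  shows "R = Fract (rat_num R) (rat_denom R)"
    and "coprime (rat_num R) (rat_denom R)"
    and "lead_coeff (rat_denom R) = 1"
proof -
  have "quot_to_fract (quot_of_fract R) = R"
    by simp
  then show "R = Fract (rat_num R) (rat_denom R)"
    by (simp add: quot_to_fract_def rat_num_def rat_denom_def)
  show "coprime (rat_num R) (rat_denom R)"
    unfolding rat_num_def rat_denom_def by (rule coprime_quot_of_fract)
  have "unit_factor (rat_denom R) = 1"
    unfolding rat_denom_def by (rule unit_factor_snd_quot_of_fract)
  then show "lead_coeff (rat_denom R) = 1"
    by (simp add: unit_factor_poly_def one_pCons monom_0)
qed

definition rat_defined_at :: "complex poly fract \<Rightarrow> complex \<Rightarrow> bool" where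
  "rat_defined_at R z \<longleftrightarrow> poly (rat_denom R) z \<noteq> 0"

definition rat_eval :: "complex poly fract \<Rightarrow> complex \<Rightarrow> complex" where
  "rat_eval R z = poly (rat_num R) z / poly (rat_denom R) z"

text \<open>Roots are counted with multiplicity.\<close>

definition sum_of_roots :: "complex poly \<Rightarrow> complex" where
  "sum_of_roots p = sum_mset (proots p)"

end

theory Submission
  imports Defs
begin

text \<open>
  If \<open>P\<close> and \<open>Q\<close> have equal degrees and leading coefficients, then
  \<open>Ln (P(n)/Q(n)) = c/n + O(1/n\<^sup>2)\<close>, where \<open>c\<close> is the difference of the sums of roots, so
  convergence of the products reduces to convergence of \<open>c \<Sum> \<delta>\<^sub>n/n\<close> and \<open>c \<Sum> \<theta>\<^sub>n/n\<close>. The partial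
  sums \<open>D\<close> of \<open>\<delta>\<close> satisfy \<open>D(qN + r) = D(q) D(N) + \<delta>\<^sub>N D(r)\<close> with \<open>\<bar>D(q)\<bar> < q\<close>, hence grow like
  \<open>N\<^sup>\<beta>\<close> with \<open>\<beta> < 1\<close>; by partial summation \<open>\<Sum> \<delta>\<^sub>n/n\<close> converges, and since \<open>\<theta> = (1 - \<delta>)/2\<close> the
  series \<open>\<Sum> \<theta>\<^sub>n/n\<close> diverges. Conversely, convergence forces \<open>P(n)/Q(n) \<rightarrow> 1\<close> along the infinitely many
  \<open>n\<close> with \<open>\<theta>\<^sub>n = 1\<close>, which determines degree and leading coefficient.
\<close>

section \<open>Rational functions at large integers\<close>

lemma degree_prod_linear_factors:
  fixes A :: "'a :: idom multiset"
  shows "degree (\<Prod>x\<in>#A. [:-x, 1:]) = size A"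
    and lead_coeff_prod_linear_factors: "lead_coeff (\<Prod>x\<in>#A. [:-x, 1:]) = 1"
proof -
  have "degree (\<Prod>x\<in>#A. [:-x, 1:]) = size A \<and> lead_coeff (\<Prod>x\<in>#A. [:-x, 1:]) = 1"
  proof (induction A)
    case (add a A)
    then have "(\<Prod>x\<in>#A. [:-x, 1:]) \<noteq> 0"
      by (metis leading_coeff_0_iff zero_neq_one)
    then have "degree ([:-a, 1:] * (\<Prod>x\<in>#A. [:-x, 1:])) = 1 + size A"
      using add by (subst degree_mult_eq) auto
    moreover have "lead_coeff ([:-a, 1:] * (\<Prod>x\<in>#A. [:-x, 1:])) = 1"
      using add by (subst lead_coeff_mult) auto
    ultimately show ?case
      by (simp only: image_mset_add_mset prod_mset.add_mset size_add_mset plus_1_eq_Suc simp_thms)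
  qed auto
  then show "degree (\<Prod>x\<in>#A. [:-x, 1:]) = size A" "lead_coeff (\<Prod>x\<in>#A. [:-x, 1:]) = 1"
    by auto
qed

text \<open>A new factor \<open>[:-a, 1:]\<close> shifts the old coefficients up by one and
  subtracts \<open>a\<close> times the leading coefficient, which is 1.\<close>

lemma coeff_pred_prod_linear_factors:
  fixes A :: "'a :: idom multiset"
  assumes "size A = Suc d"
  shows "coeff (\<Prod>x\<in>#A. [:-x, 1:]) d = - sum_mset A"
  using assms
proof (induction A arbitrary: d)
  case (add a A)
  have d: "size A = d" using add.prems by simp
  have top: "coeff (\<Prod>x\<in>#A. [:-x, 1:]) d = 1"
    using degree_prod_linear_factors[of A] lead_coeff_prod_linear_factors[of A] d by simp
  show ?case
  proof (cases d)
    case 0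
    then show ?thesis using d by simp
  next
    case (Suc e)
    then show ?thesis using add.IH[of e] top d by simp
  qed
qed simp

lemma coeff_pred_degree_eq_sum_of_roots:
  assumes "degree p = Suc d"
  shows "coeff p d = - (lead_coeff p * sum_of_roots p)"
proof -
  have "coeff p d = coeff (smult (lead_coeff p) (\<Prod>x\<in>#proots p. [:-x, 1:])) d"
    by (subst complex_poly_decompose_multiset) (rule refl)
  then show ?thesis
    using coeff_pred_prod_linear_factors[of "proots p" d] assms
    by (simp add: size_proots_complex sum_of_roots_def)
qed

section \<open>Quotients of polynomials at infinity\<close>

text \<open>Using \<open>coeff p (degree q)\<close> instead of \<open>lead_coeff p\<close> covers a
  numerator of smaller degree as well: that coefficient is then 0.\<close>

lemma poly_divide_tendsto_coeff_at_infinity: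
  fixes p q :: "'a :: real_normed_field poly"
  assumes "degree p \<le> degree q" and "q \<noteq> 0"
  shows "((\<lambda>x. poly p x / poly q x) \<longlongrightarrow> coeff p (degree q) / lead_coeff q) at_infinity"
proof (cases "degree p < degree q")
  case True
  then show ?thesis
    using poly_divide_tendsto_0_at_infinity[OF True] by (simp add: coeff_eq_0)
next
  case False
  then have deg: "degree p = degree q" using assms by simp
  have "((\<lambda>x. (poly p x / x ^ degree p) / (poly q x / x ^ degree q)) \<longlongrightarrow>
           lead_coeff p / lead_coeff q) at_infinity"
    using assms by (intro tendsto_divide poly_divide_tendsto_aux) auto
  moreover have "\<forall>\<^sub>F x in at_infinity. (poly p x / x ^ degree p) / (poly q x / x ^ degree q) =
      poly p x / poly q x"
    by (rule eventually_at_infinityI[of 1]) (auto simp: deg)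
  ultimately show ?thesis
    unfolding deg by (rule Lim_transform_eventually)
qed

text \<open>A quotient with smaller degree on top would tend to 0; the opposite case follows by
  inverting. The filter is arbitrary so that a limit along a subsequence is enough.\<close>

lemma poly_ratio_tendsto_1_imp:
  fixes p q :: "'a :: real_normed_field poly"
  assumes lim: "((\<lambda>x. poly p (f x) / poly q (f x)) \<longlongrightarrow> 1) F"
    and f: "filterlim f at_infinity F" and F: "F \<noteq> bot" and "p \<noteq> 0" "q \<noteq> 0"
  shows "degree p = degree q \<and> lead_coeff p = lead_coeff q"
proof -
  have *: "degree p' = degree q' \<and> lead_coeff p' = lead_coeff q'"
    if "degree p' \<le> degree q'" "q' \<noteq> 0" "((\<lambda>x. poly p' (f x) / poly q' (f x)) \<longlongrightarrow> 1) F"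
    for p' q' :: "'a poly"
  proof -
    have "((\<lambda>x. poly p' (f x) / poly q' (f x)) \<longlongrightarrow> coeff p' (degree q') / lead_coeff q') F"
      by (rule filterlim_compose[OF poly_divide_tendsto_coeff_at_infinity f]) (use that in auto)
    then have "coeff p' (degree q') / lead_coeff q' = 1"
      using that(3) F tendsto_unique by blast
    then have "coeff p' (degree q') = lead_coeff q'"
      using that(2) by (simp add: field_simps)
    moreover from this have "degree q' \<le> degree p'"
      using that(2) by (intro le_degree) auto
    ultimately show ?thesis using that(1) by (metis antisym)
  qed
  show ?thesis
  proof (cases "degree p \<le> degree q")
    case True
    then show ?thesis using * assms by blast
  next
    case False
    have "((\<lambda>x. inverse (poly p (f x) / poly q (f x))) \<longlongrightarrow> inverse 1) F"
      by (intro tendsto_inverse lim) simp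
    then have "((\<lambda>x. poly q (f x) / poly p (f x)) \<longlongrightarrow> 1) F"
      by simp
    then show ?thesis using *[of q p] False assms by auto
  qed
qed

text \<open>Multiplied by \<open>x^2\<close>, the remainder is \<open>x * s / q\<close> with
  \<open>s = x * (p - q) - c * q\<close>. By Vieta this \<open>c\<close> cancels the top coefficient
  of \<open>s\<close>, so \<open>x * s\<close> has degree at most that of \<open>q\<close> and the
  quotient stays bounded.\<close>

lemma poly_ratio_expansion_bigo:
  assumes deg: "degree p = degree q" and lc: "lead_coeff p = lead_coeff q" and "q \<noteq> 0"
  defines "c \<equiv> sum_of_roots q - sum_of_roots p"
  shows "(\<lambda>n. poly p (of_nat n) / poly q (of_nat n) - 1 - c / of_nat n)
           \<in> O(\<lambda>n. 1 / of_nat n ^ 2)"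
proof -
  define s where "s = [:0, 1:] * (p - q) - smult c q"
  have "degree ([:0, 1:] * s) \<le> degree q"
  proof (cases "degree q")
    case 0
    \<comment> \<open>Vieta needs positive degree; equal constants have no roots, so
      \<open>c = 0\<close>.\<close>
    then have "p = q" using deg lc by (metis degree_eq_zeroE lead_coeff_pCons(2))
    then have "s = 0" by (simp add: s_def c_def)
    then show ?thesis by simp
  next
    case (Suc d)
    have eq: "coeff (p - q) d = c * lead_coeff q"
      using coeff_pred_degree_eq_sum_of_roots[of p d] coeff_pred_degree_eq_sum_of_roots[of q d]
        Suc deg lc by (simp add: c_def algebra_simps)
    have "coeff s k = 0" if "k > d" for k
    proof -
      from that obtain k' where k': "k = Suc k'" by (cases k) auto
      show ?thesis
      proof (cases "k' = d")
        case True
        then show ?thesis using eq Suc k' by (simp add: s_def)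
      next
        case False
        then have "k' > d" using that k' by simp
        then have "coeff p k' = coeff q k'"
          using Suc deg lc by (cases "k' = Suc d") (auto simp: coeff_eq_0)
        moreover have "coeff q k = 0" using \<open>k' > d\<close> k' Suc by (simp add: coeff_eq_0)
        ultimately show ?thesis using k' by (simp add: s_def)
      qed
    qed
    then have "degree s \<le> d" by (intro degree_le) auto
    then show ?thesis using Suc by (simp add: degree_pCons_le)
  qed
  then have "((\<lambda>x. poly ([:0, 1:] * s) x / poly q x) \<longlongrightarrow>
      coeff ([:0, 1:] * s) (degree q) / lead_coeff q) at_infinity"
    using \<open>q \<noteq> 0\<close> by (rule poly_divide_tendsto_coeff_at_infinity)
  then have "((\<lambda>n. poly ([:0, 1:] * s) (of_nat n) / poly q (of_nat n)) \<longlongrightarrow>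
      coeff ([:0, 1:] * s) (degree q) / lead_coeff q) sequentially"
    by (rule filterlim_compose) (rule tendsto_of_nat)
  then have 1: "(\<lambda>n. poly ([:0, 1:] * s) (of_nat n) / poly q (of_nat n)) \<in> O(\<lambda>_::nat. 1)"
    by (intro bigoI_tendsto[where c = "coeff ([:0, 1:] * s) (degree q) / lead_coeff q"]) auto
  have "finite {n::nat. poly q (of_nat n) = 0}"
    using finite_vimageI[OF poly_roots_finite[OF \<open>q \<noteq> 0\<close>], of "of_nat :: nat \<Rightarrow> complex"]
    by (simp add: vimage_def inj_on_def)
  then have "\<forall>\<^sub>F n in sequentially. poly q (of_nat n) \<noteq> 0"
    using eventually_cofinite[of "\<lambda>n. poly q (of_nat n) \<noteq> 0"] by (simp add: cofinite_eq_sequentially)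
  then have 2: "\<forall>\<^sub>F n in sequentially. poly p (of_nat n) / poly q (of_nat n) - 1 - c / of_nat n =
      poly ([:0, 1:] * s) (of_nat n) / poly q (of_nat n) * (1 / of_nat n ^ 2)"
    using eventually_gt_at_top[of 0]
    by eventually_elim (simp add: s_def field_simps power2_eq_square)
  have "(\<lambda>n. poly ([:0, 1:] * s) (of_nat n) / poly q (of_nat n) * (1 / of_nat n ^ 2))
      \<in> O(\<lambda>n. 1 * (1 / of_nat n ^ 2 :: complex))"
    by (intro landau_o.big.mult 1) simp
  then show ?thesis
    using landau_o.big.in_cong[OF 2] by simp
qed

section \<open>From products to weighted series\<close>

text \<open>With \<open>u = z n - 1\<close>, which is O(1/n), the error in Ln(1 + u) = u + O(u^2) is
  O(1/n^2).\<close>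

lemma Ln_expansion_bigo:
  fixes z :: "nat \<Rightarrow> complex"
  assumes z: "(\<lambda>n. z n - 1 - c / of_nat n) \<in> O(\<lambda>n. 1 / of_nat n ^ 2)"
  shows "z \<longlonglongrightarrow> 1"
    and "(\<lambda>n. Ln (z n) - c / of_nat n) \<in> O(\<lambda>n. 1 / of_nat n ^ 2)"
proof -
  have sq: "(\<lambda>n. 1 / of_nat n ^ 2) \<in> O(\<lambda>n. 1 / of_nat n :: complex)"
    by (rule landau_o.bigI[of 1])
       (auto simp: norm_divide norm_mult field_simps power2_eq_square
         intro!: eventually_at_top_linorderI[of 1])
  have c: "(\<lambda>n. c / of_nat n) \<in> O(\<lambda>n. 1 / of_nat n :: complex)"
    by (rule landau_o.bigI[of "norm c + 1"])
       (auto simp: norm_divide add_nonneg_pos divide_right_mono)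
  have small: "(\<lambda>n. z n - 1) \<in> O(\<lambda>n. 1 / of_nat n :: complex)"
    using sum_in_bigo(1)[OF landau_o.big_trans[OF z sq] c] by simp
  have "((\<lambda>n. z n - 1) \<longlongrightarrow> 0) sequentially"
  proof -
    have "(\<lambda>n. 1 / of_nat n :: complex) \<in> o(\<lambda>_. 1)"
      by (rule smalloI_tendsto) (simp_all add: lim_1_over_n)
    with small have "(\<lambda>n. z n - 1) \<in> o(\<lambda>_. 1)"
      by (rule landau_o.big_small_trans)
    then show ?thesis by (auto dest: smalloD_tendsto)
  qed
  then show lim: "z \<longlonglongrightarrow> 1" by (simp add: LIM_zero_iff)
  \<comment> \<open>The bound 1/2 turns the factor \<open>1 / (1 - norm u)\<close> of the linear
    approximation into at most 2.\<close>
  have "\<forall>\<^sub>F n in sequentially. norm (z n - 1) < 1 / 2"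
    using lim[THEN tendstoD, of "1 / 2"] by (simp add: dist_norm)
  then have "\<forall>\<^sub>F n in sequentially. norm (Ln (z n) - (z n - 1)) \<le> 2 * norm ((z n - 1) ^ 2)"
  proof eventually_elim
    case (elim n)
    then have "norm (Ln (1 + (z n - 1)) - (z n - 1)) \<le> norm (z n - 1) ^ 2 / (1 - norm (z n - 1))"
      by (intro Ln_approx_linear) simp
    also have "\<dots> \<le> norm (z n - 1) ^ 2 / (1 / 2)"
      using elim by (intro divide_left_mono) auto
    finally show ?case by (simp add: norm_power)
  qed
  then have "(\<lambda>n. Ln (z n) - (z n - 1)) \<in> O(\<lambda>n. (z n - 1) ^ 2)"
    by (intro landau_o.bigI[of 2]) auto
  also have "(\<lambda>n. (z n - 1) ^ 2) \<in> O(\<lambda>n. (1 / of_nat n) ^ 2)"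
    by (intro landau_o.big_power small)
  finally have "(\<lambda>n. Ln (z n) - (z n - 1)) \<in> O(\<lambda>n. 1 / of_nat n ^ 2)"
    by (simp add: power_divide)
  from sum_in_bigo(1)[OF this z]
  show "(\<lambda>n. Ln (z n) - c / of_nat n) \<in> O(\<lambda>n. 1 / of_nat n ^ 2)" by simp
qed

lemma summable_weighted_bigo_inverse_square:
  fixes f w :: "nat \<Rightarrow> complex"
  assumes f: "f \<in> O(\<lambda>n. 1 / of_nat n ^ 2)" and w: "\<And>n. norm (w n) \<le> 1"
  shows "summable (\<lambda>n. w n * f n)"
proof -
  obtain C where C: "\<forall>\<^sub>F n in sequentially. norm (f n) \<le> C * norm (1 / of_nat n ^ 2 :: complex)"
    using f by (auto elim: landau_o.bigE)
  have "summable (\<lambda>n. C * (1 / real n ^ 2))"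
    using inverse_power_summable[of 2, where 'a = real]
    by (intro summable_mult) (simp add: inverse_eq_divide)
  moreover from C have "\<forall>\<^sub>F n in sequentially. norm (norm (w n * f n)) \<le> C * (1 / real n ^ 2)"
  proof eventually_elim
    case (elim n)
    have "norm (w n) * norm (f n) \<le> 1 * norm (f n)"
      by (intro mult_right_mono w) simp
    then show ?case using elim by (simp add: norm_mult norm_divide norm_power)
  qed
  ultimately have "summable (\<lambda>n. norm (w n * f n))"
    by (rule summable_comparison_test_ev[rotated])
  then show ?thesis by (rule summable_norm_cancel)
qed

text \<open>Serves both products: \<open>w\<close> is \<delta> or \<theta>, and \<open>f\<close> is
  the corresponding power of \<open>z\<close>. The logarithms differ from
  \<open>w n * (c / n)\<close> by a summable sequence. \<open>Ln_f\<close> is only required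
  eventually because inversion commutes with \<open>Ln\<close> up to sign only off the branch
  cut.\<close>

lemma convergent_prod_iff_summable_weighted:
  fixes f z w :: "nat \<Rightarrow> complex"
  assumes z: "(\<lambda>n. z n - 1 - c / of_nat n) \<in> O(\<lambda>n. 1 / of_nat n ^ 2)"
    and f: "\<And>n. n \<ge> 1 \<Longrightarrow> f n \<noteq> 0"
    and Ln_f: "\<forall>\<^sub>F n in sequentially. Ln (f n) = w n * Ln (z n)"
    and w: "\<And>n. norm (w n) \<le> 1"
  shows "convergent_prod (\<lambda>n. f (Suc n)) \<longleftrightarrow> summable (\<lambda>n. w n * (c / of_nat n))"
proof -
  have diff: "summable (\<lambda>n. w n * (Ln (z n) - c / of_nat n))"
    by (intro summable_weighted_bigo_inverse_square Ln_expansion_bigo z w)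
  \<comment> \<open>The criterion requires every factor to be nonzero, which is known from index 1
    on; the term at 0 can be added once the question is about a series.\<close>
  have "convergent_prod (\<lambda>n. f (Suc n)) \<longleftrightarrow> summable (\<lambda>n. Ln (f (Suc n)))"
    by (intro convergent_prod_iff_summable_complex f) simp
  also have "\<dots> \<longleftrightarrow> summable (\<lambda>n. Ln (f n))"
    by (rule summable_Suc_iff)
  also have "\<dots> \<longleftrightarrow> summable (\<lambda>n. w n * Ln (z n))"
    by (rule summable_cong[OF Ln_f])
  also have "\<dots> \<longleftrightarrow> summable (\<lambda>n. w n * (c / of_nat n))"
  proof
    assume "summable (\<lambda>n. w n * Ln (z n))"
    from summable_diff[OF this diff] show "summable (\<lambda>n. w n * (c / of_nat n))"
      by (simp add: right_diff_distrib)
  next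
    assume "summable (\<lambda>n. w n * (c / of_nat n))"
    from summable_add[OF this diff] show "summable (\<lambda>n. w n * Ln (z n))"
      by (simp add: right_diff_distrib)
  qed
  finally show ?thesis .
qed


section \<open>The Thue-Morse sequence\<close>

locale binary_thue_morse =
  fixes q :: nat and ts :: "nat list" and \<theta> :: "nat \<Rightarrow> nat"
  assumes q: "q \<ge> 2" and len: "length ts = q - 1" and letters: "set ts \<subseteq> {0, 1}"
    and nontrivial: "ts \<noteq> replicate (q - 1) 0"
    and theta: "\<And>n. \<theta> n = thue_morse ts !! n"
begin

section \<open>Block structure of the sequence\<close>

lemma fixed_point: "tm_fixed_point ts (thue_morse ts)"
  using q len letters by (intro tm_fixed_point_thue_morse) auto

lemma theta_rec: "\<theta> n = tm_morphism ts (\<theta> (n div q)) ! (n mod q)"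
  using tm_fixed_point_rec[OF fixed_point, of n] q len by (simp add: theta)

lemma theta_0: "\<theta> 0 = 0"
  using fixed_point by (simp add: theta tm_fixed_point_def)

lemma theta_less: "r < q \<Longrightarrow> \<theta> r = (0 # ts) ! r"
  using theta_rec[of r] by (simp add: theta_0 tm_morphism_def)

lemma theta_cases: "\<theta> n = 0 \<or> \<theta> n = 1"
proof -
  have "n mod q < length (tm_morphism ts (\<theta> (n div q)))" using q len by simp
  from nth_mem[OF this] have "\<theta> n \<in> set (tm_morphism ts (\<theta> (n div q)))"
    by (simp only: theta_rec[of n, symmetric])
  then show ?thesis using tm_morphism_letters[OF letters] by blast
qed

text \<open>Positions \<open>q * N\<close> to \<open>q * N + q - 1\<close> hold the image of the
  letter \<open>\<theta> N\<close>: the initial word of length \<open>q\<close>, or its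
  complement.\<close>

lemma theta_mult_add:
  assumes "r < q"
  shows "\<theta> (q * N + r) = (if \<theta> N = 0 then \<theta> r else 1 - \<theta> r)"
proof -
  have "\<theta> (q * N + r) = tm_morphism ts (\<theta> N) ! r"
    using theta_rec[of "q * N + r"] assms by simp
  then show ?thesis
    using assms len q by (cases r) (auto simp: tm_morphism_def theta_less)
qed

text \<open>The signs \<delta> taken as reals for the estimates; complementing a letter becomes a
  change of sign.\<close>

definition sgn_seq :: "nat \<Rightarrow> real" where "sgn_seq n = (-1) ^ \<theta> n"

lemma sgn_seq_mult_add: "r < q \<Longrightarrow> sgn_seq (q * N + r) = sgn_seq N * sgn_seq r"
  using theta_cases[of N] theta_cases[of r] by (auto simp: sgn_seq_def theta_mult_add)

lemma abs_sgn_seq [simp]: "\<bar>sgn_seq n\<bar> = 1"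
  by (simp add: sgn_seq_def power_abs)

lemma exists_theta_1: obtains k where "k < q" "\<theta> k = 1"
proof -
  have "\<exists>x\<in>set ts. x \<noteq> 0"
    using nontrivial len by (metis replicate_eqI)
  then obtain j where j: "j < length ts" "ts ! j \<noteq> 0"
    by (auto simp: in_set_conv_nth)
  then have "Suc j < q" "\<theta> (Suc j) \<noteq> 0" using len by (auto simp: theta_less)
  then show ?thesis using that[of "Suc j"] theta_cases[of "Suc j"] by simp
qed

text \<open>If \<open>\<theta> N = 0\<close>, block \<open>N\<close> is an uncomplemented copy of
  the initial word and contains a 1 at offset \<open>k\<close>. These indices later carry the
  necessity argument.\<close>

lemma infinite_theta_1: "infinite {n. \<theta> n = 1}"
proof -
  obtain k where k: "k < q" "\<theta> k = 1" by (rule exists_theta_1)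
  have "\<exists>n\<ge>N. \<theta> n = 1" for N
  proof (cases "\<theta> N = 1")
    case False
    then have "\<theta> (q * N + k) = 1" using k theta_cases[of N] by (simp add: theta_mult_add)
    moreover have "q * N + k \<ge> N" using q by (simp add: trans_le_add1)
    ultimately show ?thesis by blast
  qed auto
  then show ?thesis by (auto simp: infinite_nat_iff_unbounded_le)
qed

section \<open>Growth of the partial sums of the signs\<close>

definition sgn_sum :: "nat \<Rightarrow> real" where "sgn_sum N = (\<Sum>n<N. sgn_seq n)"

lemma abs_sgn_sum_le: "\<bar>sgn_sum N\<bar> \<le> N"
  unfolding sgn_sum_def by (rule order_trans[OF sum_abs]) simp

text \<open>Full block \<open>m\<close> contributes \<open>sgn_seq m * sgn_sum q\<close>; what
  remains is an initial piece of block \<open>N\<close>.\<close>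

lemma sgn_sum_mult_add:
  assumes "r \<le> q"
  shows "sgn_sum (q * N + r) = sgn_sum q * sgn_sum N + sgn_seq N * sgn_sum r"
proof -
  have block: "sgn_sum (q * N + r) = sgn_sum (q * N) + sgn_seq N * sgn_sum r" if "r \<le> q" for N r
    using that
  proof (induction r)
    case (Suc r)
    then show ?case
      using sgn_seq_mult_add[of r N] by (simp add: sgn_sum_def distrib_left)
  qed (simp add: sgn_sum_def)
  have "sgn_sum (q * N) = sgn_sum q * sgn_sum N"
  proof (induction N)
    case (Suc N)
    have "sgn_sum (q * Suc N) = sgn_sum (q * N) + sgn_seq N * sgn_sum q"
      using block[of q N] by (simp add: add.commute)
    also have "\<dots> = sgn_sum q * sgn_sum (Suc N)"
      using Suc by (simp add: sgn_sum_def algebra_simps)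
    finally show ?case .
  qed (simp add: sgn_sum_def)
  then show ?thesis using block[OF assms] by simp
qed

text \<open>The signs at 0 and at \<open>k\<close> cancel, leaving \<open>q - 2\<close> terms of
  modulus 1.\<close>

lemma abs_sgn_sum_q_le: "\<bar>sgn_sum q\<bar> \<le> real q - 1"
proof -
  obtain k where k: "k < q" "\<theta> k = 1" by (rule exists_theta_1)
  have k0: "k \<noteq> 0" using k theta_0 by (metis zero_neq_one)
  have "sgn_sum q = (\<Sum>n\<in>{..<q} - {0, k}. sgn_seq n) + (\<Sum>n\<in>{0, k}. sgn_seq n)"
    unfolding sgn_sum_def using k q by (intro sum.subset_diff) auto
  also have "(\<Sum>n\<in>{0, k}. sgn_seq n) = 0" using k k0 by (simp add: sgn_seq_def theta_0)
  finally have "\<bar>sgn_sum q\<bar> \<le> (\<Sum>n\<in>{..<q} - {0, k}. \<bar>sgn_seq n\<bar>)"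
    using sum_abs[of sgn_seq "{..<q} - {0, k}"] by (simp only: add_0_right)
  also have "\<dots> = real q - 2"
  proof -
    have "card ({..<q} - {0, k}) = q - 2"
      using k k0 q by (subst card_Diff_subset) auto
    then show ?thesis using q by (simp add: of_nat_diff)
  qed
  finally show ?thesis by simp
qed

text \<open>Any exponent \<open>\<beta> < 1\<close> with \<open>q\<^sup>\<beta> > \<bar>D(q)\<bar>\<close> would do; here \<open>q\<^sup>\<beta> = q - 1/2\<close>.\<close>

definition growth_exp :: real where "growth_exp = log q (q - 1 / 2)"

lemma growth_exp: "0 < growth_exp" "growth_exp < 1" "real q powr growth_exp = q - 1 / 2"
  using q by (auto simp: growth_exp_def)

text \<open>Removing the last base-\<open>q\<close> digit multiplies the bound by at most
  \<open>q - 1\<close> and adds at most \<open>q\<close>. The constant \<open>2 * q\<close> makes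
  this extra \<open>q\<close> half a unit of the bound, which is why \<open>q - 1/2\<close> is the
  growth factor.\<close>

lemma sgn_sum_growth: "\<bar>sgn_sum n\<bar> \<le> 2 * real q * real n powr growth_exp"
proof (induction n rule: less_induct)
  case (less n)
  define N r where "N = n div q" and "r = n mod q"
  have n: "n = q * N + r" and r: "r < q" using q by (auto simp: N_def r_def)
  have sr: "\<bar>sgn_sum r\<bar> \<le> q" using abs_sgn_sum_le[of r] r by simp
  show ?case
  proof (cases "N = 0")
    case True
    show ?thesis
    proof (cases "n = 0")
      case False
      then have "1 \<le> real n powr growth_exp" using growth_exp by (intro ge_one_powr_ge_zero) auto
      then have "real q * 1 \<le> 2 * real q * real n powr growth_exp"
        by (intro mult_mono) auto
      then show ?thesis using sr True n by simp
    qed (simp add: sgn_sum_def)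
  next
    case False
    then have "N < n" using q unfolding N_def by (intro div_less_dividend) (auto intro: Nat.gr0I)
    define y where "y = real N powr growth_exp"
    have y: "y \<ge> 1" unfolding y_def using growth_exp False by (intro ge_one_powr_ge_zero) auto
    have "\<bar>sgn_sum n\<bar> \<le> \<bar>sgn_sum q\<bar> * \<bar>sgn_sum N\<bar> + \<bar>sgn_sum r\<bar>"
      using abs_triangle_ineq[of "sgn_sum q * sgn_sum N" "sgn_seq N * sgn_sum r"]
      unfolding n sgn_sum_mult_add[OF less_imp_le[OF r]] by (simp add: abs_mult)
    also have "\<dots> \<le> (real q - 1) * (2 * real q * y) + q"
      using less.IH[OF \<open>N < n\<close>] sr abs_sgn_sum_q_le y q
      by (intro add_mono mult_mono) (auto simp: y_def)
    \<comment> \<open>As \<open>y\<close> is at least 1, the additive \<open>q\<close> is absorbed: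
      \<open>(q - 1) * 2 * q * y + q * y = 2 * q * (q - 1/2) * y\<close>.\<close>
    also have "\<dots> \<le> (real q - 1) * (2 * real q * y) + q * y"
      using y q by simp
    also have "\<dots> = 2 * real q * (real q powr growth_exp * y)"
      by (simp add: growth_exp algebra_simps)
    also have "\<dots> = 2 * real q * real (q * N) powr growth_exp"
      by (simp add: y_def powr_mult)
    also have "\<dots> \<le> 2 * real q * real n powr growth_exp"
      using growth_exp n by (intro mult_left_mono powr_mono2) auto
    finally show ?thesis .
  qed
qed

section \<open>The series with weights \<delta> and \<theta>\<close>

text \<open>Summation by parts: a telescoping part converges because \<open>sgn_sum n / n\<close>
  tends to 0, and the rest is O(n^(\<beta> - 2)) with \<beta> < 1, where \<beta> is
  \<open>growth_exp\<close>.\<close>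

lemma summable_sgn_seq_over_n: "summable (\<lambda>n. sgn_seq n / n)"
proof -
  have "(\<lambda>n. sgn_sum n / n) \<longlonglongrightarrow> 0"
  proof (rule Lim_null_comparison)
    show "\<forall>\<^sub>F n in sequentially. norm (sgn_sum n / n) \<le> 2 * real q * real n powr (growth_exp - 1)"
      using eventually_gt_at_top[of 0]
    proof eventually_elim
      case (elim n)
      then show ?case using sgn_sum_growth[of n] by (simp add: powr_diff divide_right_mono)
    qed
    have "(\<lambda>n. real n powr (growth_exp - 1)) \<longlonglongrightarrow> 0"
      using growth_exp by (intro tendsto_neg_powr filterlim_real_sequentially) auto
    then show "(\<lambda>n. 2 * real q * real n powr (growth_exp - 1)) \<longlonglongrightarrow> 0"
      using tendsto_mult_right_zero by blast
  qed
  then have 1: "summable (\<lambda>n. sgn_sum (Suc n) / Suc n - sgn_sum n / n)"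
    by (rule telescope_summable)
  have 2: "summable (\<lambda>n. sgn_sum (Suc n) * (1 / n - 1 / Suc n))"
  proof (rule summable_comparison_test_ev)
    show "\<forall>\<^sub>F n in sequentially. norm (sgn_sum (Suc n) * (1 / n - 1 / Suc n)) \<le>
        4 * real q * real n powr (growth_exp - 2)"
      using eventually_gt_at_top[of 0]
    proof eventually_elim
      case (elim n)
      \<comment> \<open>Replacing \<open>Suc n\<close> by \<open>2 * n\<close> costs at most a
        factor 2, which turns the constant \<open>2 * q\<close> into \<open>4 * q\<close>.\<close>
      have "real (Suc n) powr growth_exp \<le> real (2 * n) powr growth_exp"
        using growth_exp elim by (intro powr_mono2) auto
      also have "\<dots> = 2 powr growth_exp * real n powr growth_exp" by (simp add: powr_mult)
      also have "\<dots> \<le> 2 powr 1 * real n powr growth_exp"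
        using growth_exp by (intro mult_right_mono powr_mono) auto
      finally have "2 * real q * real (Suc n) powr growth_exp \<le> 2 * real q * (2 * real n powr growth_exp)"
        by (intro mult_left_mono) auto
      then have a: "\<bar>sgn_sum (Suc n)\<bar> \<le> 4 * real q * real n powr growth_exp"
        using sgn_sum_growth[of "Suc n"] by simp
      have b: "\<bar>1 / n - 1 / Suc n\<bar> \<le> 1 / real n ^ 2"
        proof -
        have "1 / n - 1 / Suc n = 1 / (real n * real (Suc n))"
          using elim by (simp add: field_simps)
        moreover have "1 / (real n * real (Suc n)) \<le> 1 / (real n * real n)"
          using elim by (intro divide_left_mono mult_left_mono) auto
        ultimately show ?thesis by (simp add: power2_eq_square)
      qed
      have "norm (sgn_sum (Suc n) * (1 / n - 1 / Suc n)) \<le>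
          4 * real q * real n powr growth_exp * (1 / real n ^ 2)"
        unfolding real_norm_def abs_mult by (intro mult_mono a b) auto
      also have "\<dots> = 4 * real q * real n powr (growth_exp - 2)"
        using elim by (simp add: powr_diff)
      finally show ?case .
    qed
    show "summable (\<lambda>n. 4 * real q * real n powr (growth_exp - 2))"
      using growth_exp by (intro summable_mult) (simp add: summable_real_powr_iff)
  qed
  \<comment> \<open>This also holds at \<open>n = 0\<close>, where division by zero gives 0 and the
    two parts cancel.\<close>
  have "sgn_seq n / n = (sgn_sum (Suc n) / Suc n - sgn_sum n / n) +
      sgn_sum (Suc n) * (1 / n - 1 / Suc n)" for n
  proof -
    have "sgn_seq n = sgn_sum (Suc n) - sgn_sum n" by (simp add: sgn_sum_def)
    then show ?thesis by (simp only: diff_divide_distrib right_diff_distrib) simp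
  qed
  then show ?thesis using summable_add[OF 1 2] by simp
qed

text \<open>Since \<delta> + 2\<theta> = 1, summability would carry over to the harmonic
  series.\<close>

lemma not_summable_theta_over_n: "\<not> summable (\<lambda>n. \<theta> n / n)"
proof
  assume "summable (\<lambda>n. \<theta> n / n)"
  then have "summable (\<lambda>n. sgn_seq n / n + 2 * (\<theta> n / n))"
    by (intro summable_add summable_sgn_seq_over_n summable_mult)
  moreover have "sgn_seq n / n + 2 * (\<theta> n / n) = inverse (real n)" for n
    using theta_cases[of n] by (auto simp: sgn_seq_def field_simps)
  ultimately show False using not_summable_harmonic[where 'a = real] by simp
qed

end

section \<open>Convergence of the products\<close>

theorem theorem1p1:
  fixes q :: nat and ts :: "nat list" and \<theta> :: "nat \<Rightarrow> nat" and \<delta> :: "nat \<Rightarrow> int"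
    and R :: "complex poly fract"
  assumes "q \<ge> 2"
    and "length ts = q - 1" and "set ts \<subseteq> {0, 1}" and "ts \<noteq> replicate (q - 1) 0"
    and "\<And>n. \<theta> n = thue_morse ts !! n"
    and "\<And>n. \<delta> n = (- 1) ^ \<theta> n"
    and "\<And>n::nat. n \<ge> 1 \<Longrightarrow> rat_defined_at R (of_nat n) \<and> rat_eval R (of_nat n) \<noteq> 0"
  shows "(convergent_prod (\<lambda>n. rat_eval R (of_nat (Suc n)) powi \<delta> (Suc n)) \<longleftrightarrow>
            degree (rat_num R) = degree (rat_denom R) \<and>
            lead_coeff (rat_num R) = lead_coeff (rat_denom R)) \<and>
         (convergent_prod (\<lambda>n. rat_eval R (of_nat (Suc n)) ^ \<theta> (Suc n)) \<longleftrightarrow>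
            degree (rat_num R) = degree (rat_denom R) \<and>
            lead_coeff (rat_num R) = lead_coeff (rat_denom R) \<and>
            sum_of_roots (rat_num R) = sum_of_roots (rat_denom R))"
proof -
  interpret binary_thue_morse q ts \<theta>
    using assms(1-5) by unfold_locales
  define P Q where "P = rat_num R" and "Q = rat_denom R"
  define z where "z = (\<lambda>n. rat_eval R (of_nat n))"
  define f where "f = (\<lambda>n. z n powi \<delta> n)"
  define g where "g = (\<lambda>n. z n ^ \<theta> n)"
  define c where "c = sum_of_roots Q - sum_of_roots P"
  have z_eq: "z = (\<lambda>n. poly P (of_nat n) / poly Q (of_nat n))"
    by (simp add: z_def rat_eval_def P_def Q_def)
  have z0: "z n \<noteq> 0" if "n \<ge> 1" for n
    using assms(7)[OF that] by (simp add: z_def)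
  have Q0: "Q \<noteq> 0" using rat_num_denom(3)[of R] by (auto simp: Q_def)
  have P0: "P \<noteq> 0" using z0[of 1] by (auto simp: z_eq)

  \<comment> \<open>Shared by both products: where \<open>\<theta> n = 1\<close>, the factor is
    \<open>inverse (z n)\<close> in the first and \<open>z n\<close> in the second.\<close>
  have necessary: "degree P = degree Q \<and> lead_coeff P = lead_coeff Q"
    if conv: "convergent_prod (\<lambda>n. h (Suc n))"
      and h: "\<And>n. \<theta> n = 1 \<Longrightarrow> h n = z n \<or> h n = inverse (z n)" for h
  proof -
    obtain r :: "nat \<Rightarrow> nat" where r: "strict_mono r" "\<forall>k. r k \<in> {n. \<theta> n = 1}"
      using infinite_enumerate[OF infinite_theta_1] by blast
    have "h \<longlonglongrightarrow> 1"
      using convergent_prod_imp_LIMSEQ[OF conv] by (subst (asm) filterlim_sequentially_Suc)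
    then have hr: "(\<lambda>k. h (r k)) \<longlonglongrightarrow> 1"
      using LIMSEQ_subseq_LIMSEQ[OF _ r(1)] by (fastforce simp: o_def)
    have "(\<lambda>k. norm (z (r k) - 1)) \<longlonglongrightarrow> 0"
    proof (rule Lim_null_comparison)
      \<comment> \<open>Whichever alternative holds at \<open>r k\<close>, one of the two summands
        equals \<open>norm (z (r k) - 1)\<close>, and both tend to 0.\<close>
      show "\<forall>\<^sub>F k in sequentially. norm (norm (z (r k) - 1)) \<le>
          norm (h (r k) - 1) + norm (inverse (h (r k)) - 1)"
      proof (intro always_eventually allI)
        fix k
        have "h (r k) = z (r k) \<or> h (r k) = inverse (z (r k))" using h r(2) by simp
        then show "norm (norm (z (r k) - 1)) \<le> norm (h (r k) - 1) + norm (inverse (h (r k)) - 1)"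
          by auto
      qed
      have "(\<lambda>k. norm (h (r k) - 1) + norm (inverse (h (r k)) - 1)) \<longlonglongrightarrow>
          norm (1 - 1 :: complex) + norm (inverse 1 - 1 :: complex)"
        by (intro tendsto_intros hr) simp
      then show "(\<lambda>k. norm (h (r k) - 1) + norm (inverse (h (r k)) - 1)) \<longlonglongrightarrow> 0" by simp
    qed
    then have "(\<lambda>k. z (r k)) \<longlonglongrightarrow> 1"
      by (simp add: tendsto_norm_zero_iff LIM_zero_iff)
    then have "(\<lambda>k. poly P (of_nat (r k)) / poly Q (of_nat (r k))) \<longlonglongrightarrow> 1"
      by (simp add: z_eq)
    moreover have "filterlim (\<lambda>k. of_nat (r k) :: complex) at_infinity sequentially"
      by (rule filterlim_compose[OF tendsto_of_nat filterlim_subseq[OF r(1)]])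
    ultimately show ?thesis
      using P0 Q0 by (rule poly_ratio_tendsto_1_imp[OF _ _ trivial_limit_sequentially])
  qed

  have f_iff: "convergent_prod (\<lambda>n. f (Suc n)) \<longleftrightarrow>
      degree P = degree Q \<and> lead_coeff P = lead_coeff Q"
  proof
    assume "convergent_prod (\<lambda>n. f (Suc n))"
    then show "degree P = degree Q \<and> lead_coeff P = lead_coeff Q"
      by (rule necessary) (simp add: f_def assms(6))
  next
    assume "degree P = degree Q \<and> lead_coeff P = lead_coeff Q"
    then have ex: "(\<lambda>n. z n - 1 - c / of_nat n) \<in> O(\<lambda>n. 1 / of_nat n ^ 2)"
      unfolding z_eq c_def using Q0 by (intro poly_ratio_expansion_bigo) auto
    \<comment> \<open>Within distance 1 of 1 the real part is positive, so
      \<open>Ln (inverse (z n)) = - Ln (z n)\<close>.\<close>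
    have "\<forall>\<^sub>F n in sequentially. norm (z n - 1) < 1"
      using Ln_expansion_bigo(1)[OF ex, THEN tendstoD, of 1] by (simp add: dist_norm)
    then have "\<forall>\<^sub>F n in sequentially. Ln (f n) = of_real (sgn_seq n) * Ln (z n)"
    proof eventually_elim
      case (elim n)
      have "\<bar>Re (z n - 1)\<bar> < 1" using abs_Re_le_cmod[of "z n - 1"] elim by linarith
      then have "z n \<notin> \<real>\<^sub>\<le>\<^sub>0" by (auto simp: complex_nonpos_Reals_iff)
      then show ?case
        using theta_cases[of n] Ln_inverse[of "z n"] by (auto simp: f_def sgn_seq_def assms(6))
    qed
    then have "convergent_prod (\<lambda>n. f (Suc n)) \<longleftrightarrow>
        summable (\<lambda>n. of_real (sgn_seq n) * (c / of_nat n))"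
      by (intro convergent_prod_iff_summable_weighted[OF ex]) (use z0 in \<open>auto simp: f_def\<close>)
    moreover have "summable (\<lambda>n. c * of_real (sgn_seq n / n))"
      by (intro summable_mult summable_of_real summable_sgn_seq_over_n)
    then have "summable (\<lambda>n. of_real (sgn_seq n) * (c / of_nat n))"
      by (simp add: mult.commute)
    ultimately show "convergent_prod (\<lambda>n. f (Suc n))" by blast
  qed

  have g_iff_c: "convergent_prod (\<lambda>n. g (Suc n)) \<longleftrightarrow> c = 0"
    if "degree P = degree Q \<and> lead_coeff P = lead_coeff Q"
  proof -
    have ex: "(\<lambda>n. z n - 1 - c / of_nat n) \<in> O(\<lambda>n. 1 / of_nat n ^ 2)"
      unfolding z_eq c_def using Q0 that by (intro poly_ratio_expansion_bigo) auto
    \<comment> \<open>Exponents 0 and 1 raise no branch question, so this holds for every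
      \<open>n\<close>.\<close>
    have "Ln (g n) = of_nat (\<theta> n) * Ln (z n)" and "norm (of_nat (\<theta> n) :: complex) \<le> 1" for n
      using theta_cases[of n] by (auto simp: g_def)
    then have "convergent_prod (\<lambda>n. g (Suc n)) \<longleftrightarrow> summable (\<lambda>n. of_nat (\<theta> n) * (c / of_nat n))"
      by (intro convergent_prod_iff_summable_weighted[OF ex]) (use z0 in \<open>auto simp: g_def\<close>)
    also have "\<dots> \<longleftrightarrow> c = 0"
    proof (rule iffI, rule ccontr)
      assume "summable (\<lambda>n. of_nat (\<theta> n) * (c / of_nat n))" and "c \<noteq> 0"
      \<comment> \<open>Dividing by \<open>c\<close> makes the terms real and leaves the divergent
        series of \<open>\<theta> n / n\<close>.\<close>
      then have "summable (\<lambda>n. Re (inverse c * (of_nat (\<theta> n) * (c / of_nat n))))"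
        by (intro summable_Re summable_mult)
      moreover have "Re (inverse c * (of_nat (\<theta> n) * (c / of_nat n))) = \<theta> n / n" for n
      proof -
        have "inverse c * (of_nat (\<theta> n) * (c / of_nat n)) = of_real (\<theta> n / n)"
          using \<open>c \<noteq> 0\<close> by simp
        then show ?thesis by (simp only: Re_complex_of_real)
      qed
      ultimately have "summable (\<lambda>n. \<theta> n / n)" by (simp only:)
      then show False using not_summable_theta_over_n by contradiction
    qed simp
    finally show ?thesis .
  qed
  have g_nec: "degree P = degree Q \<and> lead_coeff P = lead_coeff Q"
    if "convergent_prod (\<lambda>n. g (Suc n))"
    using that by (rule necessary) (simp add: g_def)
  have "convergent_prod (\<lambda>n. g (Suc n)) \<longleftrightarrow> degree P = degree Q \<and> lead_coeff P = lead_coeff Q \<and>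
      sum_of_roots P = sum_of_roots Q"
  proof (cases "degree P = degree Q \<and> lead_coeff P = lead_coeff Q")
    case True
    then show ?thesis using g_iff_c by (auto simp: c_def)
  next
    case False
    then show ?thesis using g_nec by blast
  qed
  with f_iff show ?thesis
    unfolding f_def g_def z_def P_def Q_def by (rule conjI)
qed

end
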